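(* Let $\mathcal H$ be a separable infinite-dimensional complex Hilbert space with a fixed orthonormal basis $\{e_n\}_{n=1}^\infty$, and let $\mathfrak F=\{f_n\}_{n=1}^\infty\subset\mathcal H$ be a B-class vector system with respect to this basis, with biorthogonal system $\{f_n^*\}_{n=1}^\infty$. Let $B(\mathfrak F)$ be the associated bipartite graph with edge weights $\hat{\mathcal L}$. Then $\mathfrak F$ is rank one dense if and only if for every infinite path $\{r_k\}_{k=1}^\infty$ in $B(\mathfrak F)$ the series $$\sum_{k=1}^\infty \lvert \hat{\mathcal L}(r_k,r_{k+1})\rvert$$ diverges.
   Context: **B-class.** Let $\{f_n\}_{n\ge1}$ be a system of vectors in $\mathcal H$ and let $\{f_n^*\}_{n\ge1}$ be a biorthogonal system to it, i.e. $\langle f_n,f_m^*\rangle=\delta_{nm}$ for all $n,m$. The system $\{f_n\}$ belongs to the B-class (with respect to $\{e_n\}$) if: (1) both $\{f_n\}$ and $\{f_n^*\}$ are complete, i.e. each has dense linear span in $\mathcal H$; (2) for every $n$, either $f_n=e_n$ or $f_n^*=e_n$; (3) $\langle f_n,e_n\rangle=\langle f_n^*,e_n\rangle=1$ for every $n$; (4) $\langle f_n,e_k\rangle=-\langle f_k^*,e_n\rangle$ for all $n\ne k$; (5) the matrices $(\langle f_n,e_k\rangle)_{n,k}$ and $(\langle f_n^*,e_k\rangle)_{n,k}$ are both finite-band, i.e. there is $d$ such that their entries vanish whenever $|n-k|>d$. **Rank one density.** Let $\mathcal A=\{T\in B(\mathcal H): Tf_n\in\overline{\operatorname{span}}(f_n)\text{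 for all }n\}$, and let $R_1(\mathcal A)$ be the algebra generated by the rank one operators belonging to $\mathcal A$. The system $\mathfrak F$ is called rank one dense if the unit ball of $R_1(\mathcal A)$ is dense in the unit ball of $\mathcal A$ in the strong operator topology. **The graph $B(\mathfrak F)$.** It is an undirected bipartite graph with one vertex $v_n$ for each index $n\ge1$. The left part consists of the $v_l$ with $f_l^*=e_l$; the right part consists of all other vertices $v_r$ (for these $f_r=e_r$). A left vertex $v_l$ and a right vertex $v_r$ are joined by an edge if and only if $\langle f_l,e_r\rangle\neq0$, and then $\hat{\mathcal L}(v_l,v_r)=\langle f_l,e_r\rangle^{-1}$ and $\hat{\mathcal L}(v_r,v_l)=-\hat{\mathcal L}(v_l,v_r)$. There are no other edges. (By (5) all vertices have finite degree.) **Infinite path.** A sequence $\{r_k\}_{k\ge1}$ of pairwise distinct vertices such that $r_k$ and $r_{k+1}$ are joined by an edge for every $k$. *)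

theory Defs
  imports "HOL-Analysis.Analysis"
begin

section \<open>Complex Hilbert spaces\<close>

text \<open>
  A complex inner product space is presented over the class of real inner product spaces
  by adding the complex scalar multiplication and the complex inner product, whose real part is
  the underlying real inner product. Positive definiteness and the identity
  \<open>norm x = sqrt (Re (cinner x x))\<close> are inherited from the real structure.
  \<open>cinner\<close> is linear in its first and conjugate-linear in its second argument.
\<close>

class complex_inner = real_inner +
  fixes scaleC :: "complex \<Rightarrow> 'a \<Rightarrow> 'a"  (infixr "*\<^sub>C" 75)
    and cinner :: "'a \<Rightarrow> 'a \<Rightarrow> complex"
  assumes scaleC_add_right: "c *\<^sub>C (x + y) = c *\<^sub>C x + c *\<^sub>C y"
    and scaleC_add_left: "(c + d) *\<^sub>C x = c *\<^sub>C x + d *\<^sub>C x"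
    and scaleC_scaleC: "c *\<^sub>C d *\<^sub>C x = (c * d) *\<^sub>C x"
    and scaleR_scaleC: "scaleR r x = complex_of_real r *\<^sub>C x"
    and cinner_commute: "cinner x y = cnj (cinner y x)"
    and cinner_add_left: "cinner (x + y) z = cinner x z + cinner y z"
    and cinner_scaleC_left: "cinner (c *\<^sub>C x) y = c * cinner x y"
    and Re_cinner: "Re (cinner x y) = inner x y"

class chilbert_space = complex_inner + complete_space

interpretation complex_vector:
  vector_space "scaleC :: complex \<Rightarrow> 'a \<Rightarrow> 'a::complex_inner"
proof
  show "1 *\<^sub>C x = x" for x :: 'a
    using scaleR_scaleC[of 1 x] by simp
qed (simp_all add: scaleC_add_right scaleC_add_left scaleC_scaleC)

lemma cinner_self: "cinner x x = complex_of_real ((norm x)\<^sup>2)"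
proof (rule complex_eqI)
  show "Im (cinner x x) = Im (complex_of_real ((norm x)\<^sup>2))"
    using arg_cong[OF cinner_commute[of x x], of Im] by simp
qed (simp add: Re_cinner dot_square_norm)

lemma norm_scaleC: "norm (c *\<^sub>C x) = cmod c * norm x"
proof -
  have "cinner (c *\<^sub>C x) (c *\<^sub>C x) = c * cnj (c * cinner x x)"
    by (metis cinner_commute cinner_scaleC_left)
  also have "\<dots> = complex_of_real ((cmod c * norm x)\<^sup>2)"
    by (simp add: cinner_self power_mult_distrib complex_norm_square[symmetric])
  finally have "(norm (c *\<^sub>C x))\<^sup>2 = (cmod c * norm x)\<^sup>2"
    unfolding cinner_self using of_real_eq_iff by blast
  then show ?thesis by simp
qed

lemma bounded_linear_scaleC: "bounded_linear (\<lambda>x. c *\<^sub>C x)"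
proof (rule bounded_linear_intro)
  show "c *\<^sub>C scaleR r x = scaleR r (c *\<^sub>C x)" for r and x :: 'a
    by (simp add: scaleR_scaleC scaleC_scaleC mult.commute)
  show "norm (c *\<^sub>C x) \<le> norm x * cmod c" for x :: 'a
    by (simp add: norm_scaleC mult.commute)
qed (rule scaleC_add_right)

definition complete_system :: "(nat \<Rightarrow> 'a::complex_inner) \<Rightarrow> bool" where
  "complete_system f \<longleftrightarrow> closure (complex_vector.span (range f)) = UNIV"

definition orthonormal_basis :: "(nat \<Rightarrow> 'a::complex_inner) \<Rightarrow> bool" where
  "orthonormal_basis e \<longleftrightarrow>
     (\<forall>n m. cinner (e n) (e m) = (if n = m then 1 else 0)) \<and> complete_system e"

section \<open>Operators\<close>

text \<open>
  The library's type of bounded linear operators is real-linear, so \<open>B(H)\<close> is the set of its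
  complex-linear elements. Operator norm, composition and
  \<^const>\<open>strong_operator_topology\<close> are those of the library.
\<close>

definition bounded_operators :: "('a::complex_inner \<Rightarrow>\<^sub>L 'a) set" where
  "bounded_operators = {T. \<forall>c x. blinfun_apply T (c *\<^sub>C x) = c *\<^sub>C blinfun_apply T x}"

lift_definition scaleC_op ::
  "complex \<Rightarrow> ('a::complex_inner \<Rightarrow>\<^sub>L 'a) \<Rightarrow> ('a \<Rightarrow>\<^sub>L 'a)"
  is "\<lambda>c T x. c *\<^sub>C T x"
  by (rule bounded_linear_compose[OF bounded_linear_scaleC])

text \<open>Not necessarily unital.\<close>

definition op_subalgebra :: "('a::complex_inner \<Rightarrow>\<^sub>L 'a) set \<Rightarrow> bool" where
  "op_subalgebra S \<longleftrightarrow>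
     0 \<in> S \<and>
     (\<forall>A\<in>S. \<forall>B\<in>S. A + B \<in> S) \<and>
     (\<forall>c. \<forall>A\<in>S. scaleC_op c A \<in> S) \<and>
     (\<forall>A\<in>S. \<forall>B\<in>S. A o\<^sub>L B \<in> S)"

definition rank_one :: "('a::complex_inner \<Rightarrow>\<^sub>L 'a) \<Rightarrow> bool" where
  "rank_one T \<longleftrightarrow>
     T \<in> bounded_operators \<and> complex_vector.dim (range (blinfun_apply T)) = 1"

definition system_algebra :: "(nat \<Rightarrow> 'a::complex_inner) \<Rightarrow> ('a \<Rightarrow>\<^sub>L 'a) set" where
  "system_algebra f =
     {T \<in> bounded_operators. \<forall>n. blinfun_apply T (f n) \<in> closure (complex_vector.span {f n})}"

definition rank_one_algebra :: "('a::complex_inner \<Rightarrow>\<^sub>L 'a) set \<Rightarrow> ('a \<Rightarrow>\<^sub>L 'a) set" where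
  "rank_one_algebra \<A> = op_subalgebra hull {T \<in> \<A>. rank_one T}"

definition unit_ball_of :: "('a::complex_inner \<Rightarrow>\<^sub>L 'a) set \<Rightarrow> ('a \<Rightarrow>\<^sub>L 'a) set" where
  "unit_ball_of S = {T \<in> S. norm T \<le> 1}"

definition rank_one_dense :: "(nat \<Rightarrow> 'a::complex_inner) \<Rightarrow> bool" where
  "rank_one_dense f \<longleftrightarrow>
     unit_ball_of (system_algebra f) \<subseteq>
       strong_operator_topology closure_of unit_ball_of (rank_one_algebra (system_algebra f))"

section \<open>The B-class and its graph\<close>

text \<open>
  Systems are indexed by \<open>nat\<close>, starting at 0 instead of 1. Throughout, \<open>e\<close> is the orthonormal
  basis, \<open>f\<close> the system and \<open>f'\<close> its biorthogonal system.
\<close>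

definition biorthogonal ::
  "(nat \<Rightarrow> 'a::complex_inner) \<Rightarrow> (nat \<Rightarrow> 'a) \<Rightarrow> bool" where
  "biorthogonal f f' \<longleftrightarrow> (\<forall>n m. cinner (f n) (f' m) = (if n = m then 1 else 0))"

definition finite_band :: "(nat \<Rightarrow> nat \<Rightarrow> complex) \<Rightarrow> bool" where
  "finite_band a \<longleftrightarrow> (\<exists>d::nat. \<forall>n k. \<bar>int n - int k\<bar> > int d \<longrightarrow> a n k = 0)"

definition B_class ::
  "(nat \<Rightarrow> 'a::complex_inner) \<Rightarrow> (nat \<Rightarrow> 'a) \<Rightarrow> (nat \<Rightarrow> 'a) \<Rightarrow> bool" where
  "B_class e f f' \<longleftrightarrow>
     biorthogonal f f' \<and>
     complete_system f \<and> complete_system f' \<and>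
     (\<forall>n. f n = e n \<or> f' n = e n) \<and>
     (\<forall>n. cinner (f n) (e n) = 1 \<and> cinner (f' n) (e n) = 1) \<and>
     (\<forall>n k. n \<noteq> k \<longrightarrow> cinner (f n) (e k) = - cinner (f' k) (e n)) \<and>
     finite_band (\<lambda>n k. cinner (f n) (e k)) \<and>
     finite_band (\<lambda>n k. cinner (f' n) (e k))"

text \<open>The vertex \<open>v\<^sub>n\<close> is represented by its index \<open>n\<close>.\<close>

definition left_part :: "(nat \<Rightarrow> 'a) \<Rightarrow> (nat \<Rightarrow> 'a) \<Rightarrow> nat set" where
  "left_part e f' = {l. f' l = e l}"

definition left_right_edge ::
  "(nat \<Rightarrow> 'a::complex_inner) \<Rightarrow> (nat \<Rightarrow> 'a) \<Rightarrow> (nat \<Rightarrow> 'a) \<Rightarrow> nat \<Rightarrow> nat \<Rightarrow> bool" where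
  "left_right_edge e f f' l r \<longleftrightarrow>
     l \<in> left_part e f' \<and> r \<notin> left_part e f' \<and> cinner (f l) (e r) \<noteq> 0"

definition B_edge ::
  "(nat \<Rightarrow> 'a::complex_inner) \<Rightarrow> (nat \<Rightarrow> 'a) \<Rightarrow> (nat \<Rightarrow> 'a) \<Rightarrow> nat \<Rightarrow> nat \<Rightarrow> bool" where
  "B_edge e f f' u v \<longleftrightarrow> left_right_edge e f f' u v \<or> left_right_edge e f f' v u"

text \<open>The value 0 off the edges is a dummy.\<close>

definition B_weight ::
  "(nat \<Rightarrow> 'a::complex_inner) \<Rightarrow> (nat \<Rightarrow> 'a) \<Rightarrow> (nat \<Rightarrow> 'a) \<Rightarrow> nat \<Rightarrow> nat \<Rightarrow> complex" where
  "B_weight e f f' u v =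
     (if left_right_edge e f f' u v then inverse (cinner (f u) (e v))
      else if left_right_edge e f f' v u then - inverse (cinner (f v) (e u))
      else 0)"

definition infinite_path :: "(nat \<Rightarrow> nat \<Rightarrow> bool) \<Rightarrow> (nat \<Rightarrow> nat) \<Rightarrow> bool" where
  "infinite_path edge r \<longleftrightarrow> inj r \<and> (\<forall>k. edge (r k) (r (Suc k)))"

end

theory Submission
  imports Defs
begin

text \<open>
  An operator \<open>T\<close> of the algebra is determined by its eigenvalues \<open>\<lambda>\<^sub>n\<close> on the vectors \<open>f n\<close>. In the
  orthonormal basis its matrix is the diagonal matrix of the \<open>\<lambda>\<^sub>n\<close> plus one entry for every edge
  of the graph, of modulus \<open>\<bar>\<lambda>\<^sub>u - \<lambda>\<^sub>v\<bar>\<close> divided by the weight of the edge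
  (\<open>coefficient_formula\<close>). Both implications are read off from this matrix, because the algebra
  generated by the rank one operators consists of the operators with finitely many nonzero
  eigenvalues, and because rank one density amounts to approximating the identity by contractions
  of that kind.

  A contraction can change its eigenvalue along an edge by at most the weight of the edge. If an
  infinite path has finite length, then a finitely supported eigenvalue sequence, which vanishes
  far out on the path, must be small on a whole tail of it, and so cannot be close to 1 at a given
  vertex of that tail (\<open>rank_one_dense_imp_not_summable\<close>).

  If all infinite paths have infinite length, then balls of the path metric are finite by Koenig's
  lemma, since the graph is locally finite (\<open>finite_short_simple_paths\<close>). A slowly decreasing
  function of the distance to \<open>{..N}\<close> is therefore a finitely supported sequence which is 1 on
  \<open>{..N}\<close> and jumps by at most \<open>\<delta>\<close> times the weight of an edge (\<open>finite_support_cutoff\<close>). The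
  matrix is banded, so the operator with these eigenvalues has norm at most \<open>1 + O(\<delta>)\<close>
  (\<open>norm_le_of_small_jumps\<close>). Rescaled to contractions, these operators converge strongly to the
  identity as \<open>N\<close> grows and \<open>\<delta>\<close> tends to 0.
\<close>

section \<open>Cut-off functions on weighted graphs\<close>

text \<open>
  Paths are stored with their endpoint first, so that extending a path by one edge is a
  \<^const>\<open>Cons\<close> and the initial segments of a path are the suffixes of its list.
\<close>

fun path_length :: "('v \<Rightarrow> 'v \<Rightarrow> real) \<Rightarrow> 'v list \<Rightarrow> real" where
  "path_length w (v # u # p) = w u v + path_length w (u # p)"
| "path_length w p = 0"

definition simple_path_from :: "('v \<Rightarrow> 'v \<Rightarrow> bool) \<Rightarrow> 'v set \<Rightarrow> 'v list \<Rightarrow> bool" where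
  "simple_path_from E A p \<longleftrightarrow>
     p \<noteq> [] \<and> distinct p \<and> last p \<in> A \<and> successively (\<lambda>v u. E u v) p"

lemma path_length_Cons: "p \<noteq> [] \<Longrightarrow> path_length w (v # p) = w (hd p) v + path_length w p"
  by (cases p) auto

lemma path_length_nonneg: "(\<And>u v. 0 \<le> w u v) \<Longrightarrow> 0 \<le> path_length w p"
  by (induction w p rule: path_length.induct) auto

lemma path_length_suffix_le:
  assumes "\<And>u v. 0 \<le> w u v"
  shows "path_length w p \<le> path_length w (s @ p)"
proof (cases "p = []")
  case True
  then show ?thesis using path_length_nonneg[of w] assms by simp
next
  case False
  then show ?thesis
    by (induction s) (simp_all add: path_length_Cons add_increasing assms)
qed

lemma simple_path_from_suffix:
  "simple_path_from E A (s @ p) \<Longrightarrow> p \<noteq> [] \<Longrightarrow> simple_path_from E A p"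
  by (auto simp: simple_path_from_def successively_append_iff)

text \<open>
  An instance of Koenig's lemma: the short paths form a finitely branching tree; if it were infinite, it
  would have an infinite branch, and that branch would be an infinite path of length at most the
  bound, hence summable.
\<close>

lemma finite_short_simple_paths:
  fixes w :: "nat \<Rightarrow> nat \<Rightarrow> real"
  assumes nonneg: "\<And>u v. 0 \<le> w u v"
    and locally_finite: "\<And>u. finite {v. E u v}"
    and diverges: "\<And>r. infinite_path E r \<Longrightarrow> \<not> summable (\<lambda>k. w (r k) (r (Suc k)))"
    and "finite A"
  shows "finite {p. simple_path_from E A p \<and> path_length w p \<le> b}"
proof (rule ccontr)
  let ?S = "{p. simple_path_from E A p \<and> path_length w p \<le> b}"
  define Ext where "Ext p = {q \<in> ?S. \<exists>s. q = s @ p}" for p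
  assume inf: "infinite ?S"
  \<comment> \<open>By local finiteness, a path with infinitely many short extensions has a one-edge extension
    with the same property; this property propagates along the branch.\<close>
  have "?S \<subseteq> (\<Union>a\<in>A. Ext [a])"
  proof
    fix q assume q: "q \<in> ?S"
    then have "q = butlast q @ [last q]" "last q \<in> A"
      by (auto simp: simple_path_from_def)
    with q show "q \<in> (\<Union>a\<in>A. Ext [a])"
      unfolding Ext_def by blast
  qed
  with inf \<open>finite A\<close> obtain a where a: "infinite (Ext [a])"
    by (meson finite_UN_I finite_subset)
  have mem: "p \<in> ?S" if p: "infinite (Ext p)" "p \<noteq> []" for p
  proof -
    obtain q where "q \<in> Ext p"
      using infinite_imp_nonempty[OF p(1)] by blast
    then obtain s where "s @ p \<in> ?S"
      by (auto simp: Ext_def)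
    then show ?thesis
      using simple_path_from_suffix[of E A s p] path_length_suffix_le[of w p s, OF nonneg] p(2)
      by auto
  qed
  have step: "\<exists>v. E (hd p) v \<and> infinite (Ext (v # p))" if p: "infinite (Ext p)" "p \<noteq> []" for p
  proof (rule ccontr)
    assume "\<not> ?thesis"
    then have "finite (\<Union>v\<in>{v. E (hd p) v}. Ext (v # p))"
      using locally_finite by blast
    moreover have "Ext p \<subseteq> insert p (\<Union>v\<in>{v. E (hd p) v}. Ext (v # p))"
    proof
      fix q assume "q \<in> Ext p"
      then obtain s where q: "q \<in> ?S" "q = s @ p"
        by (auto simp: Ext_def)
      show "q \<in> insert p (\<Union>v\<in>{v. E (hd p) v}. Ext (v # p))"
      proof (cases s rule: rev_cases)
        case Nil
        then show ?thesis using q by simp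
      next
        case (snoc s' v)
        then have eq: "q = s' @ v # p" using q by simp
        moreover have "E (hd p) v"
          using q(1) \<open>p \<noteq> []\<close> unfolding eq
          by (auto simp: simple_path_from_def successively_append_iff successively_Cons)
        ultimately show ?thesis using q(1) unfolding Ext_def by blast
      qed
    qed
    ultimately show False
      using p(1) by (meson finite_insert finite_subset)
  qed
  have "\<exists>P. \<forall>n. (infinite (Ext (P n)) \<and> P n \<noteq> []) \<and> (\<exists>v. E (hd (P n)) v \<and> P (Suc n) = v # P n)"
    using dependent_nat_choice[of "\<lambda>_ p. infinite (Ext p) \<and> p \<noteq> []"
        "\<lambda>_ p q. \<exists>v. E (hd p) v \<and> q = v # p"] a step
    by (metis list.distinct(1))
  then obtain P where P: "\<And>n. infinite (Ext (P n))" "\<And>n. P n \<noteq> []"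
    and P_Suc: "\<And>n. \<exists>v. E (hd (P n)) v \<and> P (Suc n) = v # P n"
    by metis
  define r where "r n = hd (P n)" for n
  have Suc: "P (Suc n) = r (Suc n) # P n" and edge: "E (r n) (r (Suc n))" for n
    using P_Suc[of n] by (auto simp: r_def)
  have r_in: "r i \<in> set (P (i + j))" for i j
  proof (induction j)
    case 0
    then show ?case using P(2) by (simp add: r_def)
  qed (simp add: Suc)
  have "r i \<noteq> r j" if "i < j" for i j
  proof -
    obtain m where m: "j = Suc (i + m)" using \<open>i < j\<close> less_iff_Suc_add by auto
    have "distinct (P j)"
      using mem[OF P] by (simp add: simple_path_from_def)
    then show ?thesis
      using r_in[of i m] Suc[of "i + m"] m by auto
  qed
  then have "inj r"
    by (metis injI linorder_neqE_nat)
  then have path: "infinite_path E r"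
    using edge by (simp add: infinite_path_def)
  have len: "path_length w (P n) = path_length w (P 0) + (\<Sum>k<n. w (r k) (r (Suc k)))" for n
    by (induction n) (simp_all add: Suc path_length_Cons P(2) flip: r_def)
  have "(\<Sum>k<n. w (r k) (r (Suc k))) \<le> b" for n
  proof -
    have "path_length w (P n) \<le> b"
      using mem[OF P] by simp
    then show ?thesis
      using len[of n] path_length_nonneg[of w "P 0", OF nonneg] by linarith
  qed
  then have "summable (\<lambda>k. w (r k) (r (Suc k)))"
    by (intro summableI_nonneg_bounded nonneg)
  with diverges[OF path] show False ..
qed

text \<open>
  The cut-off is \<open>max 0 (1 - \<delta> \<cdot> dist A v)\<close> for the path metric given by \<open>w\<close>, written as a
  supremum over paths so that vertices which cannot be reached from \<open>A\<close> get the value 0. Its support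
  is a ball of radius \<open>1 / \<delta>\<close>, which is finite by the previous lemma.
\<close>

lemma finite_support_cutoff:
  fixes w :: "nat \<Rightarrow> nat \<Rightarrow> real"
  assumes nonneg: "\<And>u v. 0 \<le> w u v"
    and w_sym: "\<And>u v. w u v = w v u"
    and E_sym: "\<And>u v. E u v \<Longrightarrow> E v u"
    and locally_finite: "\<And>u. finite {v. E u v}"
    and diverges: "\<And>r. infinite_path E r \<Longrightarrow> \<not> summable (\<lambda>k. w (r k) (r (Suc k)))"
    and "finite A" and "0 < \<delta>"
  obtains c :: "nat \<Rightarrow> real" where
    "\<And>v. 0 \<le> c v" "\<And>v. c v \<le> 1" "\<And>v. v \<in> A \<Longrightarrow> c v = 1" "finite {v. c v \<noteq> 0}"
    "\<And>u v. E u v \<Longrightarrow> \<bar>c u - c v\<bar> \<le> \<delta> * w u v"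
proof
  define X where
    "X v = insert 0 {1 - \<delta> * path_length w p | p. simple_path_from E A p \<and> hd p = v}" for v
  define c where "c v = Sup (X v)" for v
  have X_le: "x \<le> 1" if "x \<in> X v" for x v
    using that \<open>0 < \<delta>\<close> path_length_nonneg[of w, OF nonneg] by (auto simp: X_def)
  then have bdd: "bdd_above (X v)" for v
    by (rule bdd_aboveI)
  have ne: "X v \<noteq> {}" for v by (simp add: X_def)
  show c_nonneg: "0 \<le> c v" for v
    unfolding c_def by (rule cSup_upper[OF _ bdd]) (simp add: X_def)
  show c_le: "c v \<le> 1" for v
    unfolding c_def by (rule cSup_least[OF ne X_le])
  show "c v = 1" if "v \<in> A" for v
  proof (rule antisym[OF c_le])
    have "simple_path_from E A [v]" using that by (simp add: simple_path_from_def)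
    then have "1 \<in> X v" unfolding X_def by force
    then show "1 \<le> c v" unfolding c_def by (rule cSup_upper[OF _ bdd])
  qed
  have "{v. c v \<noteq> 0} \<subseteq> hd ` {p. simple_path_from E A p \<and> path_length w p \<le> 1 / \<delta>}"
  proof
    fix v assume "v \<in> {v. c v \<noteq> 0}"
    then have "0 < Sup (X v)" using c_nonneg[of v] by (simp add: c_def)
    then obtain x where "x \<in> X v" "0 < x"
      using less_cSup_iff[OF ne bdd] by blast
    then obtain p where "simple_path_from E A p" "hd p = v" "0 < 1 - \<delta> * path_length w p"
      by (auto simp: X_def)
    then show "v \<in> hd ` {p. simple_path_from E A p \<and> path_length w p \<le> 1 / \<delta>}"
      using \<open>0 < \<delta>\<close> by (auto simp: field_simps intro!: image_eqI[of _ _ p])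
  qed
  then show "finite {v. c v \<noteq> 0}"
    by (rule finite_subset)
      (intro finite_imageI finite_short_simple_paths nonneg locally_finite diverges \<open>finite A\<close>)
  have decrease: "c u - \<delta> * w u v \<le> c v" if "E u v" for u v
  proof -
    have "x \<le> c v + \<delta> * w u v" if "x \<in> X u" for x
    proof (cases "x = 0")
      case True
      then show ?thesis using c_nonneg[of v] nonneg[of u v] \<open>0 < \<delta>\<close> by simp
    next
      case False
      with that obtain p where p: "simple_path_from E A p" "hd p = u"
        and x: "x = 1 - \<delta> * path_length w p"
        by (auto simp: X_def)
      \<comment> \<open>If the path already meets \<open>v\<close>, the extension by the edge is cut back to its initial
        segment ending at \<open>v\<close>.\<close>
      obtain q where q: "simple_path_from E A q" "hd q = v"
        and len: "path_length w q \<le> path_length w p + w u v"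
      proof (cases "v \<in> set p")
        case True
        then obtain s t where st: "p = s @ v # t"
          by (meson split_list)
        show ?thesis
        proof (rule that[of "v # t"])
          show "simple_path_from E A (v # t)"
            using p(1) st simple_path_from_suffix[of E A s "v # t"] by simp
          show "path_length w (v # t) \<le> path_length w p + w u v"
            using path_length_suffix_le[of w "v # t" s, OF nonneg] nonneg[of u v] st by simp
        qed simp
      next
        case False
        show ?thesis
        proof (rule that[of "v # p"])
          show "simple_path_from E A (v # p)"
            using p False \<open>E u v\<close> by (auto simp: simple_path_from_def successively_Cons)
          show "path_length w (v # p) \<le> path_length w p + w u v"
            using p by (simp add: path_length_Cons simple_path_from_def)
        qed simp
      qed
      have "1 - \<delta> * path_length w q \<in> X v"
        using q by (auto simp: X_def)
      then have "1 - \<delta> * path_length w q \<le> c v"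
        unfolding c_def by (rule cSup_upper[OF _ bdd])
      moreover have "\<delta> * path_length w q \<le> \<delta> * path_length w p + \<delta> * w u v"
        using mult_left_mono[OF len, of \<delta>] \<open>0 < \<delta>\<close> by (simp add: distrib_left)
      ultimately show ?thesis using x by simp
    qed
    then have "c u \<le> c v + \<delta> * w u v"
      unfolding c_def[of u] by (rule cSup_least[OF ne])
    then show ?thesis by simp
  qed
  show "\<bar>c u - c v\<bar> \<le> \<delta> * w u v" if "E u v" for u v
    using decrease[OF that] decrease[OF E_sym[OF that]] w_sym[of u v] by simp
qed

section \<open>Complex inner products and orthonormal bases\<close>

lemma cinner_add_right: "cinner x (y + z) = cinner x y + cinner x (z :: 'a::complex_inner)"
  by (metis cinner_add_left cinner_commute complex_cnj_add)

lemma cinner_scaleC_right: "cinner x (c *\<^sub>C y) = cnj c * cinner x (y :: 'a::complex_inner)"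
  by (metis cinner_commute cinner_scaleC_left complex_cnj_mult)

lemma cmod_cinner_le: "cmod (cinner x y) \<le> norm x * norm (y :: 'a::complex_inner)"
proof (cases "cinner x y = 0")
  case False
  define u where "u = cnj (cinner x y) / cmod (cinner x y)"
  have "cmod u = 1" using False by (simp add: u_def norm_divide)
  have "u * cinner x y = cmod (cinner x y)"
    using False by (simp add: u_def field_simps complex_norm_square[symmetric] power2_eq_square
        flip: of_real_mult)
  then have "cmod (cinner x y) = Re (cinner (u *\<^sub>C x) y)"
    by (simp add: cinner_scaleC_left)
  also have "\<dots> \<le> norm (u *\<^sub>C x) * norm y"
    unfolding Re_cinner by (rule norm_cauchy_schwarz)
  finally show ?thesis by (simp add: norm_scaleC \<open>cmod u = 1\<close>)
qed simp

lemma bounded_linear_cinner_left: "bounded_linear (\<lambda>x. cinner x (y :: 'a::complex_inner))"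
  by (rule bounded_linear_intro[where K = "norm y"])
    (simp_all add: cinner_add_left scaleR_scaleC cinner_scaleC_left cmod_cinner_le scaleR_conv_of_real)

lemma bounded_linear_cinner_right: "bounded_linear (\<lambda>y. cinner (x :: 'a::complex_inner) y)"
  by (rule bounded_linear_intro[where K = "norm x"])
    (simp_all add: cinner_add_right scaleR_scaleC cinner_scaleC_right cmod_cinner_le
      scaleR_conv_of_real mult.commute[of "norm _" "norm x"])

lemmas cinner_zero_left [simp] = linear_0[OF bounded_linear.linear[OF bounded_linear_cinner_left]]
  and cinner_zero_right [simp] = linear_0[OF bounded_linear.linear[OF bounded_linear_cinner_right]]
  and cinner_diff_left = linear_diff[OF bounded_linear.linear[OF bounded_linear_cinner_left]]
  and cinner_sum_left = linear_sum[OF bounded_linear.linear[OF bounded_linear_cinner_left]]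
  and cinner_sum_right = linear_sum[OF bounded_linear.linear[OF bounded_linear_cinner_right]]

lemmas continuous_on_cinner_left =
    bounded_linear.continuous_on[OF bounded_linear_cinner_left]
  and continuous_on_cinner_right =
    bounded_linear.continuous_on[OF bounded_linear_cinner_right]

lemma complete_system_induct:
  assumes "complete_system g"
    and "\<And>n. P (g n)"
    and "complex_vector.subspace {x. P x}"
    and "closed {x. P x}"
  shows "P x"
proof -
  have "complex_vector.span (range g) \<subseteq> {x. P x}"
    by (rule complex_vector.span_minimal) (use assms in auto)
  then have "closure (complex_vector.span (range g)) \<subseteq> {x. P x}"
    by (rule closure_minimal[OF _ assms(4)])
  with assms(1) show ?thesis
    unfolding complete_system_def by blast
qed

lemma orthogonal_complete_system_eq_0:
  assumes "complete_system g" "\<And>n. cinner x (g n) = 0"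
  shows "x = 0"
proof -
  have "cinner x x = 0"
  proof (rule complete_system_induct[OF assms(1), where P = "\<lambda>y. cinner x y = 0"])
    show "closed {y. cinner x y = 0}"
      by (intro closed_Collect_eq continuous_on_cinner_right continuous_intros)
  qed (simp_all add: assms(2) complex_vector.subspace_def cinner_add_right cinner_scaleC_right)
  then show ?thesis by (simp add: cinner_self)
qed

locale orthonormal_system =
  fixes e :: "nat \<Rightarrow> 'a::complex_inner"
  assumes basis: "orthonormal_basis e"
begin

lemma cinner_e: "cinner (e n) (e m) = (if n = m then 1 else 0)"
  and complete_e: "complete_system e"
  using basis by (auto simp: orthonormal_basis_def)

lemma norm_e: "norm (e n) = 1"
proof -
  have "complex_of_real ((norm (e n))\<^sup>2) = of_real 1"
    unfolding cinner_self[symmetric] by (simp add: cinner_e)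
  then have "(norm (e n))\<^sup>2 = 1"
    by (simp only: of_real_eq_iff)
  then show ?thesis
    using norm_ge_zero[of "e n"] by (auto simp: power2_eq_1_iff)
qed

lemma cinner_sum_e:
  "finite K \<Longrightarrow> cinner (\<Sum>n\<in>K. c n *\<^sub>C e n) (e m) = (if m \<in> K then c m else 0)"
  by (simp add: cinner_sum_left cinner_scaleC_left cinner_e if_distrib cong: if_cong)

lemma finite_expansion:
  assumes "finite K" "\<And>n. n \<notin> K \<Longrightarrow> cinner x (e n) = 0"
  shows "x = (\<Sum>n\<in>K. cinner x (e n) *\<^sub>C e n)"
proof -
  have "x - (\<Sum>n\<in>K. cinner x (e n) *\<^sub>C e n) = 0"
    by (rule orthogonal_complete_system_eq_0[OF complete_e])
      (simp add: cinner_diff_left cinner_sum_e assms)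
  then show ?thesis by simp
qed

lemma norm_sum_e_power2:
  assumes "finite K"
  shows "(norm (\<Sum>n\<in>K. c n *\<^sub>C e n))\<^sup>2 = (\<Sum>n\<in>K. (cmod (c n))\<^sup>2)"
proof -
  let ?y = "\<Sum>n\<in>K. c n *\<^sub>C e n"
  have "complex_of_real ((norm ?y)\<^sup>2) = (\<Sum>n\<in>K. cnj (c n) * cinner ?y (e n))"
    unfolding cinner_self[symmetric] by (simp only: cinner_sum_right cinner_scaleC_right)
  also have "\<dots> = (\<Sum>n\<in>K. complex_of_real ((cmod (c n))\<^sup>2))"
    by (intro sum.cong refl)
      (simp only: cinner_sum_e[OF assms] if_True complex_norm_square mult.commute)
  finally show ?thesis by (simp only: of_real_eq_iff flip: of_real_sum)
qed

lemma bessel: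
  assumes "finite K"
  shows "(\<Sum>n\<in>K. (cmod (cinner x (e n)))\<^sup>2) \<le> (norm x)\<^sup>2"
proof -
  let ?y = "\<Sum>n\<in>K. cinner x (e n) *\<^sub>C e n"
  have y: "(norm ?y)\<^sup>2 = (\<Sum>n\<in>K. (cmod (cinner x (e n)))\<^sup>2)"
    by (rule norm_sum_e_power2[OF assms])
  have "cinner x ?y = (\<Sum>n\<in>K. complex_of_real ((cmod (cinner x (e n)))\<^sup>2))"
    by (simp only: cinner_sum_right cinner_scaleC_right complex_norm_square mult.commute)
  then have "cinner x ?y = complex_of_real ((norm ?y)\<^sup>2)"
    by (simp only: y of_real_sum)
  then have "(norm ?y)\<^sup>2 \<le> norm x * norm ?y"
    using cmod_cinner_le[of x ?y] by (simp add: norm_power)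
  then have "norm ?y \<le> norm x"
    by (cases "norm ?y = 0") (simp_all add: power2_eq_square)
  then show ?thesis
    unfolding y[symmetric] by (simp add: power_mono)
qed

text \<open>
  A single diagonal of a banded matrix acts as a weighted shift, and an injective shift of the
  coefficients does not increase the norm by Bessel's inequality. Injectivity is asked only where
  the weights are nonzero, so that truncated subtraction is harmless when \<open>\<sigma>\<close> lowers indices.
\<close>

lemma norm_weighted_shift_le:
  assumes "finite K" "0 \<le> \<delta>"
    and inj: "inj_on \<sigma> {n \<in> K. c n \<noteq> 0}"
    and bound: "\<And>n. n \<in> K \<Longrightarrow> cmod (c n) \<le> \<delta> * cmod (cinner x (e (\<sigma> n)))"
  shows "norm (\<Sum>n\<in>K. c n *\<^sub>C e n) \<le> \<delta> * norm x"
proof (rule power2_le_imp_le)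
  let ?K = "{n \<in> K. c n \<noteq> 0}"
  have "(norm (\<Sum>n\<in>K. c n *\<^sub>C e n))\<^sup>2 = (\<Sum>n\<in>?K. (cmod (c n))\<^sup>2)"
    unfolding norm_sum_e_power2[OF \<open>finite K\<close>]
    by (rule sum.mono_neutral_right) (use \<open>finite K\<close> in auto)
  also have "\<dots> \<le> (\<Sum>n\<in>?K. (\<delta> * cmod (cinner x (e (\<sigma> n))))\<^sup>2)"
    by (intro sum_mono power_mono bound) auto
  also have "\<dots> = \<delta>\<^sup>2 * (\<Sum>m\<in>\<sigma> ` ?K. (cmod (cinner x (e m)))\<^sup>2)"
    by (simp add: sum.reindex[OF inj] power_mult_distrib sum_distrib_left)
  also have "\<dots> \<le> \<delta>\<^sup>2 * (norm x)\<^sup>2"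
    by (intro mult_left_mono bessel) (use \<open>finite K\<close> in auto)
  finally show "(norm (\<Sum>n\<in>K. c n *\<^sub>C e n))\<^sup>2 \<le> (\<delta> * norm x)\<^sup>2"
    by (simp add: power_mult_distrib)
qed (use assms in simp)

end

section \<open>The diagonal algebra of a biorthogonal system\<close>

text \<open>\<open>ketbra u v\<close> is the operator written \<open>u \<otimes> v\<close> or, in physics, as a ket times a bra.\<close>

lift_definition ketbra :: "'a::complex_inner \<Rightarrow> 'a \<Rightarrow> ('a \<Rightarrow>\<^sub>L 'a)"
  is "\<lambda>u v x. cinner x v *\<^sub>C u"
proof (rule bounded_linear_intro)
  show "norm (cinner x v *\<^sub>C u) \<le> norm x * (norm v * norm u)" for x u v :: 'a
    using mult_right_mono[OF cmod_cinner_le[of x v] norm_ge_zero[of u]]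
    by (simp add: norm_scaleC mult.assoc)
qed (simp_all add: cinner_add_left scaleC_add_left scaleR_scaleC cinner_scaleC_left scaleC_scaleC)

lemma bounded_operatorsD: "T \<in> bounded_operators \<Longrightarrow> T (c *\<^sub>C x) = c *\<^sub>C T x"
  by (simp add: bounded_operators_def)

lemma ketbra_in_bounded_operators: "ketbra u v \<in> bounded_operators"
  by (simp add: bounded_operators_def ketbra.rep_eq cinner_scaleC_left scaleC_scaleC)

lemma op_subalgebra_sum:
  assumes "op_subalgebra S" "\<And>i. i \<in> I \<Longrightarrow> A i \<in> S"
  shows "sum A I \<in> S"
  using assms(2) by (induction I rule: infinite_finite_induct)
    (use assms(1) in \<open>auto simp: op_subalgebra_def\<close>)

lemma op_subalgebra_rank_one_algebra: "op_subalgebra (rank_one_algebra \<A>)"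
  unfolding rank_one_algebra_def by (rule hull_in) (simp add: op_subalgebra_def)

locale biorthogonal_system =
  fixes f f' :: "nat \<Rightarrow> 'a::complex_inner"
  assumes biorth: "biorthogonal f f'"
    and complete_f: "complete_system f"
begin

lemma cinner_f_f': "cinner (f n) (f' m) = (if n = m then 1 else 0)"
  using biorth by (simp add: biorthogonal_def)

lemma f_nonzero: "f n \<noteq> 0"
  using cinner_f_f'[of n n] by auto

definition eigenvalue :: "('a \<Rightarrow>\<^sub>L 'a) \<Rightarrow> nat \<Rightarrow> complex" where
  "eigenvalue T n = cinner (T (f n)) (f' n)"

text \<open>
  The span of \<open>f n\<close> is already closed, being the fixed point set of the bounded projection
  \<open>ketbra (f n) (f' n)\<close>.
\<close>

lemma closure_span_f: "y \<in> closure (complex_vector.span {f n}) \<Longrightarrow> y = cinner y (f' n) *\<^sub>C f n"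
proof -
  let ?C = "{y. y = ketbra (f n) (f' n) y}"
  have "complex_vector.span {f n} \<subseteq> ?C"
    by (auto simp: complex_vector.span_singleton ketbra.rep_eq cinner_scaleC_left cinner_f_f')
  moreover have "closed ?C"
    by (intro closed_Collect_eq continuous_intros)
  ultimately have "closure (complex_vector.span {f n}) \<subseteq> ?C"
    by (rule closure_minimal)
  then show "y \<in> closure (complex_vector.span {f n}) \<Longrightarrow> y = cinner y (f' n) *\<^sub>C f n"
    by (auto simp: ketbra.rep_eq)
qed

lemma system_algebra_apply: "T \<in> system_algebra f \<Longrightarrow> T (f n) = eigenvalue T n *\<^sub>C f n"
  unfolding eigenvalue_def by (rule closure_span_f) (simp add: system_algebra_def)

lemma system_algebraI:
  assumes "T \<in> bounded_operators" "\<And>n. T (f n) = c n *\<^sub>C f n"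
  shows "T \<in> system_algebra f" "eigenvalue T n = c n"
proof -
  have "c n *\<^sub>C f n \<in> closure (complex_vector.span {f n})" for n
    by (rule subsetD[OF closure_subset])
      (intro complex_vector.span_scale complex_vector.span_base singletonI)
  then show "T \<in> system_algebra f"
    using assms by (simp add: system_algebra_def)
  show "eigenvalue T n = c n"
    using assms(2) by (simp add: eigenvalue_def cinner_scaleC_left cinner_f_f')
qed

lemma system_algebra_operator: "T \<in> system_algebra f \<Longrightarrow> T \<in> bounded_operators"
  by (simp add: system_algebra_def)

text \<open>
  This says that the adjoint of \<open>T\<close> is diagonal in the biorthogonal system. It is clear on the
  vectors \<open>f m\<close> and passes to all vectors by density.
\<close>

lemma cinner_system_algebra:
  assumes T: "T \<in> system_algebra f"
  shows "cinner (T x) (f' n) = eigenvalue T n * cinner x (f' n)"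
proof (rule complete_system_induct[OF complete_f,
      where P = "\<lambda>x. cinner (T x) (f' n) = eigenvalue T n * cinner x (f' n)"])
  show "cinner (T (f m)) (f' n) = eigenvalue T n * cinner (f m) (f' n)" for m
    by (simp add: system_algebra_apply[OF T] cinner_scaleC_left cinner_f_f')
  show "closed {x. cinner (T x) (f' n) = eigenvalue T n * cinner x (f' n)}"
    by (intro closed_Collect_eq continuous_on_cinner_left continuous_intros)
qed (auto simp: complex_vector.subspace_def blinfun.add_right blinfun.zero_right
      bounded_operatorsD[OF system_algebra_operator[OF T]]
      cinner_add_left cinner_scaleC_left algebra_simps)

text \<open>
  Eigenvectors for two nonzero eigenvalues would be independent vectors in the range, so a rank
  one operator has at most one nonzero eigenvalue. Finiteness of the set of nonzero eigenvalues survives the algebra operations.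
\<close>

lemma rank_one_algebra_finite_eigenvalues:
  assumes "D \<in> rank_one_algebra (system_algebra f)"
  shows "D \<in> system_algebra f" "finite {n. eigenvalue D n \<noteq> 0}"
proof -
  let ?S = "{T \<in> system_algebra f. finite {n. eigenvalue T n \<noteq> 0}}"
  have "{T \<in> system_algebra f. rank_one T} \<subseteq> ?S"
  proof clarify
    fix T assume T: "T \<in> system_algebra f" "rank_one T"
    then have "complex_vector.dim (range T) = 1"
      by (simp add: rank_one_def)
    then obtain B where B: "range T \<subseteq> complex_vector.span B" "card B = 1"
      by (metis complex_vector.basis_exists)
    then obtain b where b: "range T \<subseteq> complex_vector.span {b}"
      by (metis card_1_singletonE)
    have "n = m" if nz: "eigenvalue T n \<noteq> 0" "eigenvalue T m \<noteq> 0" for n m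
    proof (rule ccontr)
      assume "n \<noteq> m"
      have "\<exists>c. eigenvalue T k *\<^sub>C f k = c *\<^sub>C b" for k
      proof -
        have "eigenvalue T k *\<^sub>C f k \<in> complex_vector.span {b}"
          unfolding system_algebra_apply[OF T(1), symmetric] using b by blast
        then show ?thesis by (auto simp: complex_vector.span_singleton)
      qed
      then obtain c d where c: "eigenvalue T n *\<^sub>C f n = c *\<^sub>C b"
        and d: "eigenvalue T m *\<^sub>C f m = d *\<^sub>C b"
        by blast
      have "c * cinner b (f' n) = eigenvalue T n" "c * cinner b (f' m) = 0"
        using c[THEN arg_cong[where f = "\<lambda>x. cinner x (f' n)"]]
          c[THEN arg_cong[where f = "\<lambda>x. cinner x (f' m)"]] \<open>n \<noteq> m\<close>
        by (simp_all add: cinner_scaleC_left cinner_f_f')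
      moreover have "d * cinner b (f' m) = eigenvalue T m"
        using d[THEN arg_cong[where f = "\<lambda>x. cinner x (f' m)"]]
        by (simp add: cinner_scaleC_left cinner_f_f')
      ultimately show False using nz by auto
    qed
    then have "\<exists>k. {n. eigenvalue T n \<noteq> 0} \<subseteq> {k}" by blast
    then show "finite {n. eigenvalue T n \<noteq> 0}"
      by (meson finite.emptyI finite.insertI finite_subset)
  qed
  moreover have "op_subalgebra ?S"
    unfolding op_subalgebra_def
  proof (intro conjI ballI allI)
    have "0 \<in> system_algebra f" "eigenvalue 0 n = 0" for n
      using system_algebraI[of 0 "\<lambda>_. 0"] by (simp_all add: bounded_operators_def)
    then show "0 \<in> ?S" by simp
  next
    fix A B assume AB: "A \<in> ?S" "B \<in> ?S"
    then have sa: "A \<in> system_algebra f" "B \<in> system_algebra f" by simp_all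
    note simps = bounded_operatorsD[OF system_algebra_operator[OF sa(1)]]
      bounded_operatorsD[OF system_algebra_operator[OF sa(2)]]
      system_algebra_apply[OF sa(1)] system_algebra_apply[OF sa(2)]
    have fin: "finite ({n. eigenvalue A n \<noteq> 0} \<union> {n. eigenvalue B n \<noteq> 0})"
      using AB by simp
    have "A + B \<in> system_algebra f" "eigenvalue (A + B) n = eigenvalue A n + eigenvalue B n" for n
      using system_algebraI[of "A + B" "\<lambda>n. eigenvalue A n + eigenvalue B n"]
      by (simp_all add: bounded_operators_def blinfun.add_left simps scaleC_add_right scaleC_add_left)
    then show "A + B \<in> ?S"
      by (auto intro!: finite_subset[OF _ fin])
    have "A o\<^sub>L B \<in> system_algebra f" "eigenvalue (A o\<^sub>L B) n = eigenvalue A n * eigenvalue B n" for n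
      using system_algebraI[of "A o\<^sub>L B" "\<lambda>n. eigenvalue A n * eigenvalue B n"]
      by (simp_all add: bounded_operators_def simps scaleC_scaleC mult.commute)
    then show "A o\<^sub>L B \<in> ?S"
      by (auto intro!: finite_subset[OF _ fin])
  next
    fix c A assume A: "A \<in> ?S"
    then have sa: "A \<in> system_algebra f" by simp
    have "scaleC_op c A \<in> system_algebra f" "eigenvalue (scaleC_op c A) n = c * eigenvalue A n" for n
      using system_algebraI[of "scaleC_op c A" "\<lambda>n. c * eigenvalue A n"]
      by (simp_all add: bounded_operators_def scaleC_op.rep_eq scaleC_scaleC mult.commute
          bounded_operatorsD[OF system_algebra_operator[OF sa]] system_algebra_apply[OF sa])
    then show "scaleC_op c A \<in> ?S"
      using A by (auto elim!: rev_finite_subset)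
  qed
  ultimately have "rank_one_algebra (system_algebra f) \<subseteq> ?S"
    unfolding rank_one_algebra_def by (rule hull_minimal)
  with assms show "D \<in> system_algebra f" "finite {n. eigenvalue D n \<noteq> 0}" by auto
qed

definition finite_diagonal :: "nat set \<Rightarrow> (nat \<Rightarrow> complex) \<Rightarrow> ('a \<Rightarrow>\<^sub>L 'a)" where
  "finite_diagonal F c = (\<Sum>n\<in>F. scaleC_op (c n) (ketbra (f n) (f' n)))"

lemma finite_diagonal_apply:
  "finite_diagonal F c x = (\<Sum>n\<in>F. (c n * cinner x (f' n)) *\<^sub>C f n)"
  by (simp add: finite_diagonal_def blinfun.sum_left scaleC_op.rep_eq ketbra.rep_eq scaleC_scaleC)

lemma finite_diagonal_f:
  assumes "finite F"
  shows "finite_diagonal F c (f n) = (if n \<in> F then c n else 0) *\<^sub>C f n"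
proof -
  have "finite_diagonal F c (f n) = (\<Sum>m\<in>F. if m = n then c n *\<^sub>C f n else 0)"
    unfolding finite_diagonal_apply by (intro sum.cong refl) (simp add: cinner_f_f')
  then show ?thesis using assms by simp
qed

lemma finite_diagonal_in_system_algebra:
  assumes "finite F"
  shows "finite_diagonal F c \<in> system_algebra f"
    "eigenvalue (finite_diagonal F c) n = (if n \<in> F then c n else 0)"
proof -
  have op: "finite_diagonal F c \<in> bounded_operators"
    by (simp add: bounded_operators_def finite_diagonal_apply cinner_scaleC_left
        complex_vector.scale_sum_right scaleC_scaleC mult.left_commute)
  note * = system_algebraI[OF op finite_diagonal_f[OF assms]]
  show "finite_diagonal F c \<in> system_algebra f"
    "eigenvalue (finite_diagonal F c) n = (if n \<in> F then c n else 0)"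
    by (rule *)+
qed

lemma finite_diagonal_in_rank_one_algebra:
  "finite_diagonal F c \<in> rank_one_algebra (system_algebra f)"
proof -
  have "ketbra (f n) (f' n) \<in> rank_one_algebra (system_algebra f)" for n
  proof -
    have range: "range (ketbra (f n) (f' n)) = complex_vector.span {f n}"
    proof
      show "range (ketbra (f n) (f' n)) \<subseteq> complex_vector.span {f n}"
        by (auto simp: ketbra.rep_eq complex_vector.span_singleton)
      have "c *\<^sub>C f n = ketbra (f n) (f' n) (c *\<^sub>C f n)" for c
        by (simp add: ketbra.rep_eq cinner_scaleC_left cinner_f_f')
      then show "complex_vector.span {f n} \<subseteq> range (ketbra (f n) (f' n))"
        by (auto simp: complex_vector.span_singleton)
    qed
    have "complex_vector.dim (range (ketbra (f n) (f' n))) = 1"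
      unfolding range by (subst complex_vector.dim_span_eq_card_independent)
        (simp_all add: f_nonzero)
    moreover have "ketbra (f n) (f' n) \<in> system_algebra f"
      by (rule system_algebraI(1)[OF ketbra_in_bounded_operators, of _ _ "\<lambda>m. if m = n then 1 else 0"])
        (simp add: ketbra.rep_eq cinner_f_f')
    ultimately have "ketbra (f n) (f' n) \<in> {T \<in> system_algebra f. rank_one T}"
      by (simp add: rank_one_def ketbra_in_bounded_operators)
    then show ?thesis
      unfolding rank_one_algebra_def by (rule hull_inc)
  qed
  then have "scaleC_op (c n) (ketbra (f n) (f' n)) \<in> rank_one_algebra (system_algebra f)" for n
    using op_subalgebra_rank_one_algebra unfolding op_subalgebra_def by blast
  then show ?thesis
    unfolding finite_diagonal_def by (intro op_subalgebra_sum op_subalgebra_rank_one_algebra)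
qed

lemma system_algebra_comp_finite_diagonal:
  assumes T: "T \<in> system_algebra f"
  shows "T o\<^sub>L finite_diagonal F c = finite_diagonal F (\<lambda>n. c n * eigenvalue T n)"
  by (rule blinfun_eqI)
    (simp add: finite_diagonal_apply blinfun.sum_right system_algebra_apply[OF T]
      bounded_operatorsD[OF system_algebra_operator[OF T]] scaleC_scaleC mult_ac)

text \<open>
  The finite diagonal operators form an ideal of the whole algebra, so contractive finite diagonal
  operators that converge strongly to the identity approximate every element of the unit ball. For
  uniformly bounded operators the convergence needs to be checked only on the complete system.
\<close>

lemma rank_one_denseI:
  assumes contr: "\<And>k::nat. norm (finite_diagonal (F k) (c k)) \<le> 1"
    and lim: "\<And>n. (\<lambda>k. finite_diagonal (F k) (c k) (f n)) \<longlonglongrightarrow> f n"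
  shows "rank_one_dense f"
  unfolding rank_one_dense_def
proof
  fix T assume "T \<in> unit_ball_of (system_algebra f)"
  then have T: "T \<in> system_algebra f" "norm T \<le> 1"
    by (simp_all add: unit_ball_of_def)
  define D where "D k = finite_diagonal (F k) (c k)" for k
  have D_le: "norm (D k x) \<le> norm x" for k x
    using norm_blinfun[of "D k" x] mult_right_mono[OF contr[of k] norm_ge_zero[of x]]
    by (simp add: D_def)
  have D_scaleC: "D k (a *\<^sub>C x) = a *\<^sub>C D k x" for k a x
    by (simp add: D_def finite_diagonal_apply cinner_scaleC_left
        complex_vector.scale_sum_right scaleC_scaleC mult.left_commute)
  have D_lim: "(\<lambda>k. D k x) \<longlonglongrightarrow> x" for x
  proof (rule complete_system_induct[OF complete_f, where P = "\<lambda>x. (\<lambda>k. D k x) \<longlonglongrightarrow> x"])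
    show "(\<lambda>k. D k (f n)) \<longlonglongrightarrow> f n" for n
      using lim by (simp add: D_def)
    show "complex_vector.subspace {x. (\<lambda>k. D k x) \<longlonglongrightarrow> x}"
      by (auto simp: complex_vector.subspace_def blinfun.zero_right blinfun.add_right D_scaleC
          intro!: tendsto_add bounded_linear.tendsto[OF bounded_linear_scaleC])
    show "closed {x. (\<lambda>k. D k x) \<longlonglongrightarrow> x}"
      unfolding closed_limpt
    proof (intro allI impI CollectI LIMSEQ_I)
      fix x :: 'a and \<epsilon> :: real
      assume "x islimpt {x. (\<lambda>k. D k x) \<longlonglongrightarrow> x}" "0 < \<epsilon>"
      then obtain y where y: "(\<lambda>k. D k y) \<longlonglongrightarrow> y" "dist y x < \<epsilon> / 3"
        unfolding islimpt_approachable by (metis mem_Collect_eq zero_less_divide_iff zero_less_numeral)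
      obtain N where N: "\<And>k. N \<le> k \<Longrightarrow> norm (D k y - y) < \<epsilon> / 3"
        using LIMSEQ_D[OF y(1), of "\<epsilon> / 3"] \<open>0 < \<epsilon>\<close> by auto
      have "norm (D k x - x) < \<epsilon>" if "N \<le> k" for k
      proof -
        have "D k x - x = D k (x - y) + (D k y - y) + (y - x)"
          by (simp add: blinfun.diff_right)
        then have "norm (D k x - x) \<le> norm (D k (x - y)) + norm (D k y - y) + norm (y - x)"
          by (simp only:) (rule order_trans[OF norm_triangle_ineq add_right_mono[OF norm_triangle_ineq]])
        also have "\<dots> < \<epsilon>"
          using D_le[of k "x - y"] N[OF that] y(2) by (simp add: dist_norm norm_minus_commute)
        finally show ?thesis .
      qed
      then show "\<exists>N. \<forall>k\<ge>N. norm (D k x - x) < \<epsilon>" by blast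
    qed
  qed
  show "T \<in> strong_operator_topology closure_of unit_ball_of (rank_one_algebra (system_algebra f))"
    unfolding in_closure_of
  proof (intro conjI allI impI)
    show "T \<in> topspace strong_operator_topology"
      by (simp add: strong_operator_topology_topspace)
    fix U assume U: "T \<in> U \<and> openin strong_operator_topology U"
    then obtain V where V: "open V" "U = blinfun_apply -` V"
      by (auto simp: strong_operator_topology_def openin_pullback_topology)
    have "(\<lambda>k. blinfun_apply (T o\<^sub>L D k)) \<longlonglongrightarrow> blinfun_apply T"
      unfolding limitin_canonical_iff[symmetric] euclidean_product_topology[symmetric]
        limitin_componentwise
      using D_lim by (auto intro!: blinfun.tendsto tendsto_const)
    then have "eventually (\<lambda>k. blinfun_apply (T o\<^sub>L D k) \<in> V) sequentially"
      using V U by (intro topological_tendstoD) auto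
    then obtain k where k: "T o\<^sub>L D k \<in> U"
      using V(2) by (auto simp: eventually_sequentially)
    have "T o\<^sub>L D k \<in> rank_one_algebra (system_algebra f)"
      unfolding D_def system_algebra_comp_finite_diagonal[OF T(1)]
      by (rule finite_diagonal_in_rank_one_algebra)
    moreover have "norm (T o\<^sub>L D k) \<le> 1"
      using norm_blinfun_compose[of T "D k"] mult_le_one[OF T(2) norm_ge_zero contr[of k]]
      by (simp add: D_def)
    ultimately show "\<exists>S. S \<in> unit_ball_of (rank_one_algebra (system_algebra f)) \<and> S \<in> U"
      using k by (auto simp: unit_ball_of_def)
  qed
qed

text \<open>Conversely, rank one density is applied to the identity and one vector of the system.\<close>

lemma rank_one_dense_eigenvalue:
  assumes "rank_one_dense f" "0 < \<epsilon>"
  obtains D where "D \<in> system_algebra f" "norm D \<le> 1" "finite {m. eigenvalue D m \<noteq> 0}"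
    "cmod (eigenvalue D n - 1) < \<epsilon>"
proof -
  let ?U = "{S :: 'a \<Rightarrow>\<^sub>L 'a. S (f n) \<in> ball (f n) (\<epsilon> * norm (f n))}"
  have "id_blinfun \<in> unit_ball_of (system_algebra f)"
    using system_algebraI(1)[of id_blinfun "\<lambda>_. 1"]
    by (simp add: unit_ball_of_def bounded_operators_def norm_blinfun_id_le)
  then have cl: "id_blinfun \<in> strong_operator_topology closure_of
      unit_ball_of (rank_one_algebra (system_algebra f))"
    using assms(1) unfolding rank_one_dense_def by blast
  have "openin strong_operator_topology ?U"
    using strong_operator_topology_basis[of "{()}" "\<lambda>_. ball (f n) (\<epsilon> * norm (f n))" "\<lambda>_. f n"]
    by simp
  moreover have "id_blinfun \<in> ?U"
    using \<open>0 < \<epsilon>\<close> f_nonzero by simp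
  ultimately obtain D where D: "D \<in> unit_ball_of (rank_one_algebra (system_algebra f))" "D \<in> ?U"
    using in_closure_of[THEN iffD1, OF cl, THEN conjunct2, rule_format, of ?U] by blast
  then have fin: "D \<in> system_algebra f" "finite {m. eigenvalue D m \<noteq> 0}"
    using rank_one_algebra_finite_eigenvalues by (auto simp: unit_ball_of_def)
  have "norm (D (f n) - f n) < \<epsilon> * norm (f n)"
    using D(2) by (simp add: dist_norm norm_minus_commute)
  moreover have "D (f n) - f n = (eigenvalue D n - 1) *\<^sub>C f n"
    by (simp add: system_algebra_apply[OF fin(1)] complex_vector.scale_left_diff_distrib)
  ultimately have "cmod (eigenvalue D n - 1) < \<epsilon>"
    using f_nonzero by (simp add: norm_scaleC)
  with fin D(1) show ?thesis
    by (intro that) (auto simp: unit_ball_of_def)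
qed

end

section \<open>Coefficients of the operators for a B-class system\<close>

locale B_class_system =
  fixes e f f' :: "nat \<Rightarrow> 'a::complex_inner"
  assumes basis: "orthonormal_basis e"
    and B_class: "B_class e f f'"
begin

sublocale orthonormal_system e
  by unfold_locales (rule basis)

sublocale biorthogonal_system f f'
  by unfold_locales (use B_class in \<open>auto simp: B_class_def\<close>)

lemma f_or_f': "f n = e n \<or> f' n = e n"
  and diag_f': "cinner (f' n) (e n) = 1"
  and skew: "n \<noteq> k \<Longrightarrow> cinner (f n) (e k) = - cinner (f' k) (e n)"
  using B_class by (auto simp: B_class_def)

definition left_neighbours :: "nat \<Rightarrow> nat set" where
  "left_neighbours n = {m. left_right_edge e f f' m n}"

lemma left_neighboursD:
  "m \<in> left_neighbours n \<Longrightarrow> f' m = e m"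
  by (simp add: left_neighbours_def left_right_edge_def left_part_def)

definition bandwidth :: "nat \<Rightarrow> bool" where
  "bandwidth d \<longleftrightarrow> (\<forall>m n. left_right_edge e f f' m n \<longrightarrow> m \<le> n + d \<and> n \<le> m + d)"

lemma bandwidth_exists: obtains d where "bandwidth d"
proof -
  have "finite_band (\<lambda>n k. cinner (f n) (e k))"
    using B_class by (simp add: B_class_def)
  then obtain d where d: "\<And>n k. \<bar>int n - int k\<bar> > int d \<Longrightarrow> cinner (f n) (e k) = 0"
    by (auto simp: finite_band_def)
  have "m \<le> n + d \<and> n \<le> m + d" if "left_right_edge e f f' m n" for m n
    using d[of m n] that by (force simp: left_right_edge_def)
  then show ?thesis
    by (intro that[of d]) (simp add: bandwidth_def)
qed

lemma finite_left_neighbours: "finite (left_neighbours n)"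
proof -
  obtain d where "bandwidth d" by (rule bandwidth_exists)
  then have "left_neighbours n \<subseteq> {..n + d}"
    by (auto simp: bandwidth_def left_neighbours_def)
  then show ?thesis by (rule finite_subset) simp
qed

text \<open>
  By skew symmetry the off-diagonal coefficients of \<open>f' n\<close> are those of the vectors \<open>f m\<close> at
  \<open>e n\<close> with the opposite sign. Such a coefficient can be nonzero only if \<open>f m\<close> is not \<open>e m\<close>
  and \<open>f' n\<close> is not \<open>e n\<close>, which makes \<open>m\<close> a left and \<open>n\<close> a right vertex. For a left vertex \<open>n\<close>
  the sum is empty.
\<close>

lemma e_expansion:
  "e n = f' n + (\<Sum>m\<in>left_neighbours n. cinner (f m) (e n) *\<^sub>C e m)"
proof -
  let ?x = "e n - f' n"
  have coeff: "cinner ?x (e m) = (if m \<in> left_neighbours n then cinner (f m) (e n) else 0)" for m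
  proof (cases "n = m")
    case True
    then have "m \<notin> left_neighbours n"
      by (simp add: left_neighbours_def left_right_edge_def)
    then show ?thesis using True by (simp add: cinner_diff_left cinner_e diag_f')
  next
    case False
    have x: "cinner ?x (e m) = cinner (f m) (e n)"
      using skew[of m n] False by (simp add: cinner_diff_left cinner_e)
    show ?thesis
    proof (cases "m \<in> left_neighbours n")
      case nb: False
      have "cinner (f m) (e n) = 0"
      proof (rule ccontr)
        assume nz: "cinner (f m) (e n) \<noteq> 0"
        then have "f m \<noteq> e m" using False by (auto simp: cinner_e)
        then have m: "f' m = e m" using f_or_f' by blast
        with nb nz have "f' n = e n"
          by (auto simp: left_neighbours_def left_right_edge_def left_part_def)
        then show False using nz cinner_f_f'[of m n] False by simp
      qed
      with x nb show ?thesis by simp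
    qed (simp add: x)
  qed
  have "?x = (\<Sum>m\<in>left_neighbours n. cinner ?x (e m) *\<^sub>C e m)"
    by (rule finite_expansion[OF finite_left_neighbours]) (simp add: coeff)
  also have "\<dots> = (\<Sum>m\<in>left_neighbours n. cinner (f m) (e n) *\<^sub>C e m)"
    by (intro sum.cong refl) (simp add: coeff)
  finally show ?thesis by (simp add: algebra_simps)
qed

text \<open>
  With respect to the orthonormal basis, an operator of the algebra is a diagonal matrix plus one
  entry per edge of the graph, which measures how much the eigenvalue jumps along that edge.
\<close>

lemma coefficient_formula:
  assumes T: "T \<in> system_algebra f"
  shows "cinner (T x) (e n) = eigenvalue T n * cinner x (e n) +
    (\<Sum>m\<in>left_neighbours n.
      cnj (cinner (f m) (e n)) * (eigenvalue T m - eigenvalue T n) * cinner x (e m))"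
proof -
  have expand: "cinner y (e n) = cinner y (f' n) +
      (\<Sum>m\<in>left_neighbours n. cnj (cinner (f m) (e n)) * cinner y (e m))" for y
    by (subst e_expansion) (simp add: cinner_add_right cinner_sum_right cinner_scaleC_right)
  have "cinner (T x) (e m) = eigenvalue T m * cinner x (e m)" if "m \<in> left_neighbours n" for m
    using cinner_system_algebra[OF T, of x m] left_neighboursD[OF that] by simp
  then have "cinner (T x) (e n) = eigenvalue T n * cinner x (f' n) +
      (\<Sum>m\<in>left_neighbours n. cnj (cinner (f m) (e n)) * (eigenvalue T m * cinner x (e m)))"
    by (simp add: expand[of "T x"] cinner_system_algebra[OF T])
  also have "cinner x (f' n) = cinner x (e n) -
      (\<Sum>m\<in>left_neighbours n. cnj (cinner (f m) (e n)) * cinner x (e m))"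
    using expand[of x] by simp
  finally show ?thesis
    by (simp add: algebra_simps sum_distrib_left sum_subtractf)
qed

text \<open>The bound is the matrix entry of \<open>T\<close> that belongs to the edge.\<close>

lemma eigenvalue_jump_le:
  assumes T: "T \<in> system_algebra f" and edge: "left_right_edge e f f' m n"
  shows "cmod (cinner (f m) (e n)) * cmod (eigenvalue T m - eigenvalue T n) \<le> norm T"
proof -
  have m: "m \<in> left_neighbours n" "m \<noteq> n"
    using edge by (auto simp: left_neighbours_def left_right_edge_def)
  have "cinner (T (e m)) (e n) = (\<Sum>k\<in>left_neighbours n. if k = m then
      cnj (cinner (f m) (e n)) * (eigenvalue T m - eigenvalue T n) else 0)"
    using m(2) by (simp add: coefficient_formula[OF T] cinner_e) (auto intro!: sum.cong)
  also have "\<dots> = cnj (cinner (f m) (e n)) * (eigenvalue T m - eigenvalue T n)"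
    using m(1) by (simp add: finite_left_neighbours)
  finally have "cmod (cinner (f m) (e n)) * cmod (eigenvalue T m - eigenvalue T n) =
      cmod (cinner (T (e m)) (e n))"
    by (simp add: norm_mult)
  also have "\<dots> \<le> norm (T (e m)) * norm (e n)"
    by (rule cmod_cinner_le)
  also have "\<dots> \<le> norm T"
    using norm_blinfun[of T "e m"] by (simp add: norm_e)
  finally show ?thesis .
qed

text \<open>
  Reindexing a row by its distance \<open>s - d\<close> from the diagonal, which lies between \<open>-d\<close> and \<open>d\<close>,
  splits a banded matrix into its diagonals.
\<close>

lemma sum_left_neighbours_by_offset:
  fixes g :: "nat \<Rightarrow> 'b::comm_monoid_add"
  assumes "bandwidth d"
  shows "(\<Sum>m\<in>left_neighbours n. g m) =
    (\<Sum>s\<le>2 * d. if d \<le> n + s \<and> n + s - d \<in> left_neighbours n then g (n + s - d) else 0)"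
proof -
  have band: "m \<le> n + d" "n \<le> m + d" if "m \<in> left_neighbours n" for m
    using that assms by (auto simp: bandwidth_def left_neighbours_def)
  have "(\<Sum>m\<in>left_neighbours n. g m) =
      (\<Sum>s\<in>{s \<in> {..2 * d}. d \<le> n + s \<and> n + s - d \<in> left_neighbours n}. g (n + s - d))"
    by (rule sum.reindex_bij_witness[where i = "\<lambda>s. n + s - d" and j = "\<lambda>m. m + d - n"])
      (use band in \<open>force+\<close>)
  also have "\<dots> = (\<Sum>s\<le>2 * d.
      if d \<le> n + s \<and> n + s - d \<in> left_neighbours n then g (n + s - d) else 0)"
    by (rule sum.inter_filter) simp
  finally show ?thesis .
qed

text \<open>
  The diagonal part is a contraction, and the part carried by the edges consists of at most
  \<open>2 * d + 1\<close> weighted shifts with weights bounded by \<open>\<delta>\<close>.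
\<close>

lemma norm_le_of_small_jumps:
  assumes T: "T \<in> system_algebra f"
    and "bandwidth d" and "0 \<le> \<delta>"
    and fin: "finite {n. eigenvalue T n \<noteq> 0}"
    and le_1: "\<And>n. cmod (eigenvalue T n) \<le> 1"
    and jump: "\<And>m n. left_right_edge e f f' m n \<Longrightarrow>
      cmod (cinner (f m) (e n)) * cmod (eigenvalue T m - eigenvalue T n) \<le> \<delta>"
  shows "norm T \<le> 1 + real (2 * d + 1) * \<delta>"
proof (rule norm_blinfun_bound)
  let ?F = "{n. eigenvalue T n \<noteq> 0}"
  fix x
  define B where "B n m =
    cnj (cinner (f m) (e n)) * (eigenvalue T m - eigenvalue T n) * cinner x (e m)" for n m
  define c where "c s n =
    (if d \<le> n + s \<and> n + s - d \<in> left_neighbours n then B n (n + s - d) else 0)" for s n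
  have coeff: "cinner (T x) (e n) = eigenvalue T n * cinner x (e n) + (\<Sum>s\<le>2 * d. c s n)" for n
    unfolding coefficient_formula[OF T] c_def B_def
    by (subst sum_left_neighbours_by_offset[OF \<open>bandwidth d\<close>]) (rule refl)
  \<comment> \<open>The range of \<open>T\<close> has coefficients only within distance \<open>d\<close> of the support of the
    eigenvalues, hence inside the finite set \<open>K\<close>.\<close>
  define K where "K = (\<Union>m\<in>?F. {..m + d})"
  have K: "finite K" using fin by (simp add: K_def)
  have "cinner (T x) (e n) = 0" if "n \<notin> K" for n
  proof -
    have "eigenvalue T m = 0" if "m \<in> left_neighbours n" for m
      using that \<open>n \<notin> K\<close> \<open>bandwidth d\<close> by (force simp: K_def bandwidth_def left_neighbours_def)
    moreover have "eigenvalue T n = 0" using that by (auto simp: K_def)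
    ultimately show ?thesis
      by (simp add: coefficient_formula[OF T])
  qed
  then have "T x = (\<Sum>n\<in>K. cinner (T x) (e n) *\<^sub>C e n)"
    by (rule finite_expansion[OF K])
  also have "\<dots> = (\<Sum>n\<in>K. (eigenvalue T n * cinner x (e n)) *\<^sub>C e n) +
      (\<Sum>s\<le>2 * d. \<Sum>n\<in>K. c s n *\<^sub>C e n)"
    by (subst sum.swap)
      (simp add: coeff scaleC_add_left sum.distrib complex_vector.scale_sum_left)
  also have "norm \<dots> \<le> norm (\<Sum>n\<in>K. (eigenvalue T n * cinner x (e n)) *\<^sub>C e n) +
      (\<Sum>s\<le>2 * d. norm (\<Sum>n\<in>K. c s n *\<^sub>C e n))"
    by (intro order_trans[OF norm_triangle_ineq] add_left_mono norm_sum)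
  also have "\<dots> \<le> 1 * norm x + (\<Sum>s\<le>2 * d. \<delta> * norm x)"
  proof (intro add_mono sum_mono)
    show "norm (\<Sum>n\<in>K. (eigenvalue T n * cinner x (e n)) *\<^sub>C e n) \<le> 1 * norm x"
      by (rule norm_weighted_shift_le[OF K, where \<sigma> = "\<lambda>n. n"])
        (auto simp: norm_mult mult_left_le_one_le le_1)
    show "norm (\<Sum>n\<in>K. c s n *\<^sub>C e n) \<le> \<delta> * norm x" for s
    proof (rule norm_weighted_shift_le[OF K \<open>0 \<le> \<delta>\<close>, where \<sigma> = "\<lambda>n. n + s - d"])
      show "inj_on (\<lambda>n. n + s - d) {n \<in> K. c s n \<noteq> 0}"
        by (auto simp: inj_on_def c_def split: if_splits)
      show "cmod (c s n) \<le> \<delta> * cmod (cinner x (e (n + s - d)))" for n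
        using jump[of "n + s - d" n] \<open>0 \<le> \<delta>\<close>
        by (auto simp: c_def B_def norm_mult left_neighbours_def intro!: mult_right_mono)
    qed
  qed
  also have "\<dots> = (1 + real (2 * d + 1) * \<delta>) * norm x"
    by (simp add: algebra_simps)
  finally show "norm (T x) \<le> (1 + real (2 * d + 1) * \<delta>) * norm x" .
qed (use \<open>0 \<le> \<delta>\<close> in simp)

lemma B_edge_sym: "B_edge e f f' u v \<Longrightarrow> B_edge e f f' v u"
  by (auto simp: B_edge_def)

lemma cmod_B_weight_sym: "cmod (B_weight e f f' u v) = cmod (B_weight e f f' v u)"
  by (auto simp: B_weight_def left_right_edge_def)

lemma cmod_B_weight_left_right:
  "left_right_edge e f f' m n \<Longrightarrow> cmod (B_weight e f f' m n) = inverse (cmod (cinner (f m) (e n)))"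
  by (simp add: B_weight_def norm_inverse)

lemma finite_B_neighbours: "finite {v. B_edge e f f' u v}"
proof -
  obtain d where "bandwidth d" by (rule bandwidth_exists)
  then have "{v. B_edge e f f' u v} \<subseteq> {..u + d}"
    by (auto simp: bandwidth_def B_edge_def)
  then show ?thesis by (rule finite_subset) simp
qed

lemma eigenvalue_jump_le_weight:
  assumes T: "T \<in> system_algebra f" "norm T \<le> 1" and "B_edge e f f' u v"
  shows "cmod (eigenvalue T u - eigenvalue T v) \<le> cmod (B_weight e f f' u v)"
proof -
  have *: "cmod (eigenvalue T m - eigenvalue T n) \<le> cmod (B_weight e f f' m n)"
    if edge: "left_right_edge e f f' m n" for m n
    using eigenvalue_jump_le[OF T(1) edge] T(2) edge cmod_B_weight_left_right[OF edge]
    by (auto simp: left_right_edge_def inverse_eq_divide pos_le_divide_eq mult.commute)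
  show ?thesis
    using assms(3) *[of u v] *[of v u] cmod_B_weight_sym[of u v]
    by (auto simp: B_edge_def norm_minus_commute)
qed

section \<open>The two implications\<close>

text \<open>
  A finitely supported eigenvalue sequence vanishes far out on the path, and under a contraction it
  changes by at most the remaining length of the path, so on a tail of length less than
  \<open>1 / 2\<close> no eigenvalue is near 1.
\<close>

lemma rank_one_dense_imp_not_summable:
  assumes dense: "rank_one_dense f" and path: "infinite_path (B_edge e f f') r"
  shows "\<not> summable (\<lambda>k. cmod (B_weight e f f' (r k) (r (Suc k))))"
proof
  let ?w = "\<lambda>k. cmod (B_weight e f f' (r k) (r (Suc k)))"
  assume sum: "summable ?w"
  obtain k where k: "\<And>n. norm (sum ?w {k..<n}) < 1 / 2"
    using summable_Cauchy[THEN iffD1, OF sum, rule_format, of "1 / 2"] by auto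
  obtain D where D: "D \<in> system_algebra f" "norm D \<le> 1" "finite {m. eigenvalue D m \<noteq> 0}"
    and near_1: "cmod (eigenvalue D (r k) - 1) < 1 / 2"
    using rank_one_dense_eigenvalue[OF dense, of "1 / 2"] by auto
  have edge: "B_edge e f f' (r i) (r (Suc i))" for i
    using path by (simp add: infinite_path_def)
  have diff: "cmod (eigenvalue D (r k) - eigenvalue D (r (k + i))) \<le> sum ?w {k..<k + i}" for i
  proof (induction i)
    case (Suc i)
    have "cmod (eigenvalue D (r k) - eigenvalue D (r (k + Suc i))) \<le>
        cmod (eigenvalue D (r k) - eigenvalue D (r (k + i))) +
        cmod (eigenvalue D (r (k + i)) - eigenvalue D (r (Suc (k + i))))"
      using norm_triangle_ineq[of "eigenvalue D (r k) - eigenvalue D (r (k + i))"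
          "eigenvalue D (r (k + i)) - eigenvalue D (r (Suc (k + i)))"] by simp
    also have "\<dots> \<le> sum ?w {k..<k + i} + ?w (k + i)"
      by (rule add_mono[OF Suc eigenvalue_jump_le_weight[OF D(1,2) edge]])
    finally show ?case by simp
  qed simp
  have "inj (\<lambda>i. r (k + i))"
    using path by (simp add: infinite_path_def inj_def) (metis add_left_cancel)
  then have "infinite (range (\<lambda>i. r (k + i)))"
    using finite_imageD infinite_UNIV_nat by blast
  then have "\<not> range (\<lambda>i. r (k + i)) \<subseteq> {m. eigenvalue D m \<noteq> 0}"
    using D(3) finite_subset by metis
  then obtain i where "eigenvalue D (r (k + i)) = 0"
    by blast
  then have "cmod (eigenvalue D (r k)) < 1 / 2"
    using diff[of i] k[of "k + i"] by simp
  with near_1 show False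
    using norm_triangle_ineq4[of "eigenvalue D (r k)" "eigenvalue D (r k) - 1"] by simp
qed

text \<open>
  The eigenvalues are a cut-off function with small jumps; dividing by the bound on the norm turns
  the operator into a contraction.
\<close>

lemma contraction_near_identity:
  assumes "bandwidth d"
    and diverges: "\<And>r. infinite_path (B_edge e f f') r \<Longrightarrow>
      \<not> summable (\<lambda>k. cmod (B_weight e f f' (r k) (r (Suc k))))"
    and "0 < \<delta>"
  obtains F c where "norm (finite_diagonal F c) \<le> 1"
    "\<And>n. n \<le> N \<Longrightarrow> finite_diagonal F c (f n) = (1 / (1 + real (2 * d + 1) * \<delta>)) *\<^sub>R f n"
proof -
  obtain c :: "nat \<Rightarrow> real" where c: "\<And>v. 0 \<le> c v" "\<And>v. c v \<le> 1" "\<And>v. v \<in> {..N} \<Longrightarrow> c v = 1"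
    and fin: "finite {v. c v \<noteq> 0}"
    and jump: "\<And>u v. B_edge e f f' u v \<Longrightarrow> \<bar>c u - c v\<bar> \<le> \<delta> * cmod (B_weight e f f' u v)"
    by (rule finite_support_cutoff[of "\<lambda>u v. cmod (B_weight e f f' u v)" "B_edge e f f'" "{..N}" \<delta>])
      (use cmod_B_weight_sym B_edge_sym finite_B_neighbours diverges \<open>0 < \<delta>\<close> in auto)
  define F where "F = {v. c v \<noteq> 0}"
  define b where "b = 1 + real (2 * d + 1) * \<delta>"
  have "0 < b" using \<open>0 < \<delta>\<close> by (simp add: b_def add_pos_nonneg)
  define T where "T = finite_diagonal F (\<lambda>n. complex_of_real (c n))"
  note F = fin[folded F_def]
  have T: "T \<in> system_algebra f"
    unfolding T_def by (rule finite_diagonal_in_system_algebra(1)[OF F])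
  have ev: "eigenvalue T n = complex_of_real (c n)" for n
    unfolding T_def finite_diagonal_in_system_algebra(2)[OF F] by (simp add: F_def)
  have "norm T \<le> b"
    unfolding b_def
  proof (rule norm_le_of_small_jumps[OF T \<open>bandwidth d\<close>])
    show "cmod (cinner (f m) (e n)) * cmod (eigenvalue T m - eigenvalue T n) \<le> \<delta>"
      if edge: "left_right_edge e f f' m n" for m n
    proof -
      have "cmod (eigenvalue T m - eigenvalue T n) = \<bar>c m - c n\<bar>"
        by (simp add: ev flip: of_real_diff)
      also have "\<dots> \<le> \<delta> * inverse (cmod (cinner (f m) (e n)))"
        using jump[of m n] edge by (simp add: B_edge_def cmod_B_weight_left_right)
      finally show ?thesis
        using edge by (simp add: field_simps left_right_edge_def)
    qed
  qed (use \<open>0 < \<delta>\<close> F c in \<open>simp_all add: ev F_def\<close>)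
  have eq: "finite_diagonal F (\<lambda>n. complex_of_real (c n / b)) = (1 / b) *\<^sub>R T"
    by (rule blinfun_eqI)
      (simp add: T_def finite_diagonal_apply blinfun.scaleR_left scaleR_scaleC
        complex_vector.scale_sum_right scaleC_scaleC)
  show ?thesis
  proof (rule that[of F "\<lambda>n. complex_of_real (c n / b)"])
    show "norm (finite_diagonal F (\<lambda>n. complex_of_real (c n / b))) \<le> 1"
      unfolding eq using \<open>norm T \<le> b\<close> \<open>0 < b\<close> by simp
    show "finite_diagonal F (\<lambda>n. complex_of_real (c n / b)) (f n) =
        (1 / (1 + real (2 * d + 1) * \<delta>)) *\<^sub>R f n" if "n \<le> N" for n
      unfolding eq b_def[symmetric] using c(3)[of n] that system_algebra_apply[OF T, of n]
      by (simp add: blinfun.scaleR_left ev)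
  qed
qed

lemma not_summable_imp_rank_one_dense:
  assumes diverges: "\<And>r. infinite_path (B_edge e f f') r \<Longrightarrow>
      \<not> summable (\<lambda>k. cmod (B_weight e f f' (r k) (r (Suc k))))"
  shows "rank_one_dense f"
proof -
  obtain d where d: "bandwidth d" by (rule bandwidth_exists)
  define s where "s k = 1 / (1 + real (2 * d + 1) * (1 / real (Suc k)))" for k
  have "\<exists>F c. norm (finite_diagonal F c) \<le> 1 \<and>
      (\<forall>n\<le>k. finite_diagonal F c (f n) = s k *\<^sub>R f n)" for k
    using contraction_near_identity[OF d diverges, of "1 / real (Suc k)" k]
    by (metis s_def of_nat_0_less_iff zero_less_Suc zero_less_divide_1_iff)
  then obtain F c where contr: "\<And>k. norm (finite_diagonal (F k) (c k)) \<le> 1"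
    and on_f: "\<And>k n. n \<le> k \<Longrightarrow> finite_diagonal (F k) (c k) (f n) = s k *\<^sub>R f n"
    by metis
  show ?thesis
  proof (rule rank_one_denseI[OF contr])
    fix n
    have "(\<lambda>k. 1 / real (Suc k)) \<longlonglongrightarrow> 0"
      using LIMSEQ_inverse_real_of_nat by (simp add: inverse_eq_divide)
    then have "s \<longlonglongrightarrow> 1 / (1 + real (2 * d + 1) * 0)"
      unfolding s_def by (intro tendsto_intros) simp_all
    then have "(\<lambda>k. s k *\<^sub>R f n) \<longlonglongrightarrow> 1 *\<^sub>R f n"
      by (intro tendsto_intros) simp
    then show "(\<lambda>k. finite_diagonal (F k) (c k) (f n)) \<longlonglongrightarrow> f n"
      using Lim_transform_eventually[of "\<lambda>k. s k *\<^sub>R f n" "f n" sequentially]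
        eventually_sequentiallyI[of n "\<lambda>k. s k *\<^sub>R f n = finite_diagonal (F k) (c k) (f n)"]
      by (simp add: on_f)
  qed
qed

end

theorem theorem2p1:
  fixes e f f' :: "nat \<Rightarrow> 'a::chilbert_space"
  assumes "orthonormal_basis e"
    and "B_class e f f'"
  shows "rank_one_dense f \<longleftrightarrow>
    (\<forall>r. infinite_path (B_edge e f f') r \<longrightarrow>
         \<not> summable (\<lambda>k. cmod (B_weight e f f' (r k) (r (Suc k)))))"
proof -
  interpret B_class_system e f f'
    by unfold_locales (rule assms)+
  show ?thesis
    using rank_one_dense_imp_not_summable not_summable_imp_rank_one_dense by blast
qed

end
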